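(* There exist knot diagrams $D$ (together with a choice of Fox coloring torsion matrix $M(D)$) for which the graph $\Gamma_{M(D)}$ is not planar.
   Context: For a reduced $k$-crossing knot diagram $D$, the Fox relations matrix $M'(D)$ is the $k\times k$ integer matrix with one row for each crossing and one column for each arc, the row of a crossing with over strand $a$ and under strands $b,c$ being the coefficients of the relation $2a-b-c=0$. The matrix $M(D)$ is obtained from $M'(D)$ by removing any one row and any one column; it is a presentation matrix for the torsion subgroup of the Fox coloring module. For a $p\times q$ matrix $X=(x_{ij})$, $\Gamma_X$ is the weighted bipartite graph with vertex sets $\{v_1,\dots,v_p\}$ and $\{w_1,\dots,w_q\}$ in which $v_iw_j$ is an edge (of weight $x_{ij}$) if and only if $x_{ij}\neq 0$. *)

theory Defs
  imports "HOL-Analysis.Analysis" "Jordan_Normal_Form.Determinant"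
begin

section \<open>Knot diagrams\<close>

text \<open>A diagram is a closed curve in the plane (traversed over the parameter interval
  \<open>[0,1)\<close>), together with the set of those parameters at which the strand
  passes under another strand.\<close>

record diagram =
  curve :: "real \<Rightarrow> complex"
  under :: "real set"

definition double_params :: "(real \<Rightarrow> complex) \<Rightarrow> real set" where
  "double_params \<gamma> = {t \<in> {0..<1}. \<exists>s \<in> {0..<1}. s \<noteq> t \<and> \<gamma> s = \<gamma> t}"

text \<open>The curve is a regular projection: piecewise smooth, with finitely many multiple points,
  each a transverse double point. The base point of the parametrization is not a crossing
  (otherwise the derivative there would be one-sided). At every double point exactly one of
  the two strands is the under strand.\<close>

definition knot_diagram :: "diagram \<Rightarrow> bool" where
  "knot_diagram D \<longleftrightarrow>
     (let \<gamma> = curve D; T = double_params \<gamma> in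
       valid_path \<gamma> \<and> pathfinish \<gamma> = pathstart \<gamma> \<and>
       finite T \<and> 0 \<notin> T \<and>
       (\<forall>t\<in>T. card {s \<in> T. \<gamma> s = \<gamma> t} = 2) \<and>
       (\<forall>t\<in>T. \<gamma> differentiable (at t)) \<and>
       (\<forall>s\<in>T. \<forall>t\<in>T. s \<noteq> t \<and> \<gamma> s = \<gamma> t \<longrightarrow>
          (\<forall>a b :: real. a *\<^sub>R vector_derivative \<gamma> (at s) + b *\<^sub>R vector_derivative \<gamma> (at t) = 0
             \<longrightarrow> a = 0 \<and> b = 0)) \<and>
       under D \<subseteq> T \<and>
       (\<forall>s\<in>T. \<forall>t\<in>T. s \<noteq> t \<and> \<gamma> s = \<gamma> t \<longrightarrow> (s \<in> under D \<longleftrightarrow> t \<notin> under D)))"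

definition crossings :: "diagram \<Rightarrow> complex set" where
  "crossings D = curve D ` double_params (curve D)"

definition crossing_number :: "diagram \<Rightarrow> nat" where
  "crossing_number D = card (crossings D)"

text \<open>A crossing is nugatory if some simple closed curve in the plane meets the diagram only
  there and has parts of the diagram on both sides.\<close>

definition nugatory :: "diagram \<Rightarrow> complex \<Rightarrow> bool" where
  "nugatory D x \<longleftrightarrow> x \<in> crossings D \<and>
     (\<exists>c :: real \<Rightarrow> complex. simple_path c \<and> pathfinish c = pathstart c \<and>
        path_image c \<inter> path_image (curve D) = {x} \<and>
        inside (path_image c) \<inter> path_image (curve D) \<noteq> {} \<and>
        outside (path_image c) \<inter> path_image (curve D) \<noteq> {})"

definition reduced_diagram :: "diagram \<Rightarrow> bool" where
  "reduced_diagram D \<longleftrightarrow> (\<forall>x\<in>crossings D. \<not> nugatory D x)"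


section \<open>Fox relations matrix\<close>

text \<open>Crossings are numbered \<open>0, \<dots>, k - 1\<close> in the order in which they are passed under.
  With \<open>u\<^sub>0 < \<dots> < u\<^sub>k\<^sub>-\<^sub>1\<close> the under parameters,
  arc \<open>j\<close> consists of the parameters between \<open>u\<^sub>j\<^sub>-\<^sub>1\<close> and \<open>u\<^sub>j\<close>
  for \<open>0 < j < k\<close>, and arc \<open>0\<close> runs from \<open>u\<^sub>k\<^sub>-\<^sub>1\<close>
  through the base point to \<open>u\<^sub>0\<close>. So crossing \<open>i\<close> ends arc \<open>i\<close>
  and starts arc \<open>i + 1\<close> modulo \<open>k\<close>.\<close>

definition under_param :: "diagram \<Rightarrow> nat \<Rightarrow> real" where
  "under_param D i = sorted_list_of_set (under D) ! i"

definition over_param :: "diagram \<Rightarrow> nat \<Rightarrow> real" where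
  "over_param D i =
     (THE t. t \<in> double_params (curve D) - under D \<and> curve D t = curve D (under_param D i))"

definition arc_of :: "diagram \<Rightarrow> real \<Rightarrow> nat" where
  "arc_of D t = card {u \<in> under D. u < t} mod crossing_number D"

definition fox_matrix :: "diagram \<Rightarrow> int mat" where
  "fox_matrix D =
     (let k = crossing_number D in
       mat k k (\<lambda>(i, j).
         2 * of_bool (j = arc_of D (over_param D i))
         - of_bool (j = i)
         - of_bool (j = (i + 1) mod k)))"

definition fox_torsion_matrix :: "diagram \<Rightarrow> nat \<Rightarrow> nat \<Rightarrow> int mat" where
  "fox_torsion_matrix D r s = mat_delete (fox_matrix D) r s"


section \<open>The bipartite graph of a matrix and planarity\<close>

record ('v, 'w) weighted_graph =
  vertices :: "'v set"
  edges :: "'v set set"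
  weight :: "'v set \<Rightarrow> 'w"

text \<open>\<open>Inl i\<close> is the row vertex \<open>v\<^sub>i\<close>, and \<open>Inr j\<close>
  the column vertex \<open>w\<^sub>j\<close>. The weight is
  only meaningful on edges.\<close>

definition matrix_graph :: "'a::zero mat \<Rightarrow> (nat + nat, 'a) weighted_graph" where
  "matrix_graph X =
     \<lparr> vertices = Inl ` {..<dim_row X} \<union> Inr ` {..<dim_col X},
       edges = {{Inl i, Inr j} | i j. i < dim_row X \<and> j < dim_col X \<and> X $$ (i, j) \<noteq> 0},
       weight = (\<lambda>e. THE x. \<exists>i j. i < dim_row X \<and> j < dim_col X \<and>
         e = {Inl i, Inr j} \<and> x = X $$ (i, j)) \<rparr>"

text \<open>A graph is planar if it can be drawn in the plane: vertices are distinct points, an edge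
  is a simple arc joining its ends and avoiding all other vertices, and distinct edges meet
  only at common ends.\<close>

definition planar :: "('v, 'w) weighted_graph \<Rightarrow> bool" where
  "planar G \<longleftrightarrow>
     (\<exists>(p :: 'v \<Rightarrow> complex) (c :: 'v set \<Rightarrow> real \<Rightarrow> complex).
        inj_on p (vertices G) \<and>
        (\<forall>e\<in>edges G. arc (c e) \<and> {pathstart (c e), pathfinish (c e)} = p ` e \<and>
           path_image (c e) \<inter> p ` vertices G = p ` e) \<and>
        (\<forall>e\<in>edges G. \<forall>e'\<in>edges G. e \<noteq> e' \<longrightarrow>
           path_image (c e) \<inter> path_image (c e') = p ` (e \<inter> e')))"

end

theory Submission
  imports Defs
begin

text \<open>The witness is a closed hexagonal line with six crossings, drawn so that one of its torsion
  matrices, of size 5, contains a subdivision of \<open>K\<^sub>3\<^sub>,\<^sub>3\<close> in its graph: three arcs of the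
  diagram take part in each of two crossings, and in a third crossing up to a detour through a
  further arc and crossing. It then remains to see three things.

  The graph is not planar. The six outer edges of \<open>K\<^sub>3\<^sub>,\<^sub>3\<close> are drawn as a closed curve, and
  each of the other three edges is a chord on one of its two sides. Any two of these chords have
  interlaced ends. By the theta curve theorem two such chords cannot both lie inside
  (\<open>crossing_chords_not_both_inside\<close>), and an inversion gives the same for the outside
  (\<open>crossing_chords_not_both_outside\<close>). Three chords and two sides are a contradiction
  (\<open>no_K33_drawing\<close>), and paths in a drawn graph are arcs, which extends this to
  subdivisions (\<open>not_planar_if_K33_subdivision\<close>).

  The diagram is reduced. A crossing whose two parameters are interlaced with those of another
  crossing can be removed without disconnecting the curve, so it is not nugatory
  (\<open>interlaced_crossing_not_nugatory\<close>). All six crossings are interlaced with another one.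

  The crossings and the matrix are as claimed. The curve is piecewise affine with rational
  vertices, so that its double points come from linear systems (\<open>star_pairsD\<close>), and the order of
  their parameters determines the arcs and the matrix (\<open>fox_torsion_matrix_star\<close>).\<close>

section \<open>Crossing chords of a closed curve\<close>

text \<open>The arc \<open>e\<close> would have to leave the region bounded by \<open>c1\<close> and \<open>d\<close>
  in order to end on \<open>c2\<close>, but it meets the boundary of that region only at its start: the
  half-open arc without its start is connected and would have points on both sides of the boundary
  without meeting it.\<close>

lemma theta_crosscut_side:
  fixes c1 c2 d e :: "real \<Rightarrow> complex"
  assumes e: "arc e"
    and u: "pathstart e \<in> path_image c1" and v: "pathfinish e \<in> path_image c2"
    and v': "pathfinish e \<notin> path_image c1 \<union> path_image d"
    and ec: "path_image e \<inter> (path_image c1 \<union> path_image d) = {pathstart e}"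
    and sub: "inside (path_image c1 \<union> path_image d) \<subseteq> inside (path_image c1 \<union> path_image c2)"
    and hit: "x \<in> path_image e" "x \<in> inside (path_image c1 \<union> path_image d)"
  shows False
proof -
  let ?S = "path_image c1 \<union> path_image d"
  have "inj_on e {0..1}" "path e" using e by (auto simp: arc_def)
  have eq: "path_image e - {pathstart e} = e ` {0<..1}"
  proof -
    have "e ` {0<..1} = e ` ({0..1} - {0})" by (rule arg_cong[where f = "image e"]) auto
    also have "\<dots> = e ` {0..1} - {e 0}"
      using \<open>inj_on e {0..1}\<close> by (subst inj_on_image_set_diff[of e "{0..1}"]) auto
    finally show ?thesis by (simp add: path_image_def pathstart_def)
  qed
  have con: "connected (path_image e - {pathstart e})"
    unfolding eq using \<open>path e\<close>
    by (intro connected_continuous_image) (auto simp: path_def intro: continuous_on_subset)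
  have "pathfinish e \<notin> inside ?S"
    using sub v inside_no_overlap[of "path_image c1 \<union> path_image c2"] by blast
  then have "pathfinish e \<in> outside ?S"
    using v' inside_Un_outside[of ?S] by blast
  moreover have "pathfinish e \<in> path_image e - {pathstart e}"
    using arc_distinct_ends[OF e] by auto
  moreover have "x \<noteq> pathstart e"
    using hit u inside_no_overlap[of ?S] by blast
  ultimately have "outside ?S \<inter> (path_image e - {pathstart e}) \<noteq> {}"
    "inside ?S \<inter> (path_image e - {pathstart e}) \<noteq> {}"
    using hit by blast+
  then have "?S \<inter> (path_image e - {pathstart e}) \<noteq> {}"
    using con inside_outside_intersect_connected by blast
  with ec show False by blast
qed

text \<open>The chord \<open>d\<close> cuts the inside of the closed curve \<open>c1 \<union> c2\<close> into two
  regions, by the theta curve theorem. The chord \<open>e\<close> avoids \<open>d\<close>, so it has a point in one of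
  these regions, while one of its ends lies on the part of the curve that does not bound this
  region.\<close>

lemma crossing_chords_not_both_inside:
  fixes c1 c2 d e :: "real \<Rightarrow> complex"
  assumes c1: "arc c1" "pathstart c1 = a" "pathfinish c1 = b"
    and c2: "arc c2" "pathstart c2 = a" "pathfinish c2 = b"
    and d: "arc d" "pathstart d = a" "pathfinish d = b"
    and e: "arc e" "pathstart e = u" "pathfinish e = v"
    and c12: "path_image c1 \<inter> path_image c2 = {a, b}"
    and dc: "path_image d \<inter> (path_image c1 \<union> path_image c2) = {a, b}"
    and ec: "path_image e \<inter> (path_image c1 \<union> path_image c2) = {u, v}"
    and de: "path_image d \<inter> path_image e = {}"
    and uv: "u \<in> path_image c1" "v \<in> path_image c2"
    and din: "path_image d \<inter> inside (path_image c1 \<union> path_image c2) \<noteq> {}"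
    and ein: "path_image e \<inter> inside (path_image c1 \<union> path_image c2) \<noteq> {}"
  shows False
proof -
  let ?H = "path_image c1 \<union> path_image c2"
  have dends: "{a, b} \<subseteq> path_image d"
    using d by (metis empty_subsetI insert_subset pathfinish_in_path_image pathstart_in_path_image)
  have eends: "u \<in> path_image e" "v \<in> path_image e"
    using e by auto
  have uv': "u \<notin> path_image c2" "v \<notin> path_image c1" "u \<notin> path_image d" "v \<notin> path_image d"
    using c12 de dends eends uv by auto
  have ec1: "path_image e \<inter> (path_image c1 \<union> path_image d) = {u}"
    unfolding Int_Un_distrib using ec de eends uv uv' by auto
  have ec2: "path_image e \<inter> (path_image c2 \<union> path_image d) = {v}"
    unfolding Int_Un_distrib using ec de eends uv uv' by auto
  have ab: "a \<noteq> b" using c1 arc_distinct_ends by blast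
  obtain S12: "inside (path_image c1 \<union> path_image d) \<union> inside (path_image c2 \<union> path_image d)
      \<union> (path_image d - {a, b}) = inside ?H"
  proof (rule split_inside_simple_closed_curve[of c1 a b c2 d])
    show "path_image c1 \<inter> path_image d = {a, b}" "path_image c2 \<inter> path_image d = {a, b}"
      using c12 dc dends by blast+
    show "path_image d \<inter> inside ?H \<noteq> {}" by (fact din)
  qed (use c1 c2 d ab c12 in \<open>simp_all add: arc_imp_simple_path\<close>)
  obtain x where x: "x \<in> path_image e" "x \<in> inside ?H" using ein by blast
  then have "x \<notin> path_image d" using de by blast
  then consider "x \<in> inside (path_image c1 \<union> path_image d)"
    | "x \<in> inside (path_image c2 \<union> path_image d)"
    using S12 x by blast
  then show False
  proof cases
    case 1
    show False
    proof (rule theta_crosscut_side[of e c1 c2 d x])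
      show "path_image e \<inter> (path_image c1 \<union> path_image d) = {pathstart e}"
        using ec1 e by simp
      show "inside (path_image c1 \<union> path_image d) \<subseteq> inside ?H"
        using S12 by blast
    qed (use 1 x e uv uv' in simp_all)
  next
    case 2
    show False
    proof (rule theta_crosscut_side[of "reversepath e" c2 c1 d x])
      show "path_image (reversepath e) \<inter> (path_image c2 \<union> path_image d) = {pathstart (reversepath e)}"
        using ec2 e by simp
      show "inside (path_image c2 \<union> path_image d) \<subseteq> inside (path_image c2 \<union> path_image c1)"
        unfolding Un_commute[of "path_image c2" "path_image c1"] using S12 by blast
    qed (use 2 x e uv uv' in \<open>simp_all add: arc_reversepath\<close>)
  qed
qed

text \<open>Inversion about a point inside a closed curve exchanges its two sides; this is how
  statements about the inside are carried over to the outside. Indeed, if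
  \<open>h w\<close> were outside the image curve, it could be joined there, avoiding 0, to a point
  \<open>h w'\<close> of large norm, and pulling the connection back would join \<open>w\<close> to a point
  \<open>w'\<close> near \<open>z0\<close> without meeting \<open>H\<close>.\<close>

lemma inversion_outside_imp_inside:
  fixes H :: "complex set"
  assumes "compact H" and z0: "z0 \<in> inside H" and w: "w \<in> outside H"
  defines "h \<equiv> \<lambda>z. inverse (z - z0)"
  shows "h w \<in> inside (h ` H)"
proof (rule ccontr)
  assume n: "h w \<notin> inside (h ` H)"
  have z0H: "z0 \<notin> H" using z0 inside_no_overlap by blast
  have wH: "w \<notin> H" "w \<noteq> z0" using w z0 outside_no_overlap inside_Int_outside by blast+
  have inj: "inj h" by (auto simp: h_def inj_def)
  have "continuous_on H h" unfolding h_def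
    using z0H by (intro continuous_intros) auto
  then have cH: "compact (h ` H)" using \<open>compact H\<close> compact_continuous_image by blast
  have hw: "h w \<in> outside (h ` H)"
    using n wH inj by (metis ComplI UnE image_iff inj_eq inside_Un_outside)
  obtain B where B: "B > 0" "\<And>z. norm z \<ge> B \<Longrightarrow> z \<in> outside (h ` H)"
  proof -
    obtain B where "- outside (h ` H) \<subseteq> ball 0 B" "B > 0"
      using cobounded_outside[OF compact_imp_bounded[OF cH]] bounded_subset_ballD by blast
    then have "B > 0" "\<And>z. norm z \<ge> B \<Longrightarrow> z \<in> outside (h ` H)" by fastforce+
    then show ?thesis using that by blast
  qed
  have "open (inside H)" using \<open>compact H\<close> by (simp add: compact_imp_closed open_inside)
  then obtain \<epsilon> where eps: "\<epsilon> > 0" "ball z0 \<epsilon> \<subseteq> inside H"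
    using z0 open_contains_ball by blast
  define r where "r = min (\<epsilon> / 2) (1 / B)"
  have r: "r > 0" "r < \<epsilon>" "1 / r \<ge> B"
    using eps B(1) by (auto simp: r_def min_def field_simps)
  define w' where "w' = z0 + of_real r"
  have w'in: "w' \<in> inside H"
    using eps r by (auto simp: w'_def dist_norm subset_iff)
  have "norm (h w') = 1 / r" using r by (simp add: h_def w'_def norm_inverse inverse_eq_divide norm_divide)
  then have hw': "h w' \<in> outside (h ` H)" using B r by simp
  define U where "U = outside (h ` H) - {0}"
  have "connected U" unfolding U_def
    using cH by (intro connected_open_delete)
      (auto simp: open_outside compact_imp_closed connected_outside compact_imp_bounded)
  define g where "g = (\<lambda>y::complex. z0 + inverse y)"
  have gh: "g (h z) = z" for z by (simp add: g_def h_def)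
  have "connected (g ` U)"
    using \<open>connected U\<close> unfolding g_def
    by (intro connected_continuous_image continuous_intros) (auto simp: U_def)
  moreover have "h w \<in> U" "h w' \<in> U"
    using hw hw' wH r by (auto simp: U_def h_def w'_def)
  then have "w \<in> g ` U" "w' \<in> g ` U" using gh by (metis imageI)+
  moreover from this have "outside H \<inter> g ` U \<noteq> {}" "inside H \<inter> g ` U \<noteq> {}"
    using w w'in by blast+
  ultimately have "H \<inter> g ` U \<noteq> {}"
    using inside_outside_intersect_connected by blast
  then obtain y where y: "y \<in> U" "g y \<in> H" by blast
  then have "h (g y) = y" by (auto simp: h_def g_def)
  then have "y \<in> h ` H" using y by (metis imageI)
  then show False using y outside_no_overlap unfolding U_def by blast
qed

lemma arc_continuous_image:
  assumes "arc g" "continuous_on (path_image g) f" "inj_on f (path_image g)"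
  shows "arc (f \<circ> g)"
  using assms by (auto simp: arc_def path_image_def intro: path_continuous_image comp_inj_on)

lemma crossing_chords_not_both_outside:
  fixes c1 c2 d e :: "real \<Rightarrow> complex"
  assumes c1: "arc c1" "pathstart c1 = a" "pathfinish c1 = b"
    and c2: "arc c2" "pathstart c2 = a" "pathfinish c2 = b"
    and d: "arc d" "pathstart d = a" "pathfinish d = b"
    and e: "arc e" "pathstart e = u" "pathfinish e = v"
    and c12: "path_image c1 \<inter> path_image c2 = {a, b}"
    and dc: "path_image d \<inter> (path_image c1 \<union> path_image c2) = {a, b}"
    and ec: "path_image e \<inter> (path_image c1 \<union> path_image c2) = {u, v}"
    and de: "path_image d \<inter> path_image e = {}"
    and uv: "u \<in> path_image c1" "v \<in> path_image c2"
    and dout: "path_image d \<inter> inside (path_image c1 \<union> path_image c2) = {}"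
    and eout: "path_image e \<inter> inside (path_image c1 \<union> path_image c2) = {}"
  shows False
proof -
  let ?H = "path_image c1 \<union> path_image c2"
  have loop: "simple_path (c1 +++ reversepath c2)"
    using c1 c2 c12 by (intro simple_path_join_loop) (auto simp: arc_reversepath)
  have im: "path_image (c1 +++ reversepath c2) = ?H"
    using c1 c2 by (simp add: path_image_join)
  have "inside ?H \<noteq> {}"
    using Jordan_inside_outside[OF loop] c1 c2 im by simp
  then obtain z0 where z0: "z0 \<in> inside ?H" by blast
  define h where "h = (\<lambda>z. inverse (z - z0))"
  have inj: "inj h" by (auto simp: h_def inj_def)
  have z0H: "z0 \<notin> ?H" using z0 inside_no_overlap by blast
  have cH: "compact ?H" using c1 c2 by (simp add: compact_Un compact_arc_image)
  have arch: "arc (h \<circ> g)" if "arc g" "z0 \<notin> path_image g" for g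
    using that inj unfolding h_def
    by (intro arc_continuous_image continuous_intros) (auto intro: inj_on_subset)
  have hit: "path_image (h \<circ> g) \<inter> inside (path_image (h \<circ> c1) \<union> path_image (h \<circ> c2)) \<noteq> {}"
    if "arc g" "path_image g \<inter> inside ?H = {}" "path_image g \<inter> ?H \<subseteq> {pathstart g, pathfinish g}" for g
  proof -
    have "infinite (path_image g)"
      using that(1) finite_imageD[of g "{0..1::real}"] infinite_Icc[of 0 "1::real"]
      unfolding arc_def path_image_def by auto
    then obtain w where "w \<in> path_image g" "w \<notin> {pathstart g, pathfinish g}"
      by (metis finite.emptyI finite_insert finite_subset subsetI)
    then have "w \<in> outside ?H" using that(2,3) inside_Un_outside[of ?H] by blast
    then have "h w \<in> inside (h ` ?H)"
      using inversion_outside_imp_inside[OF cH z0] by (simp add: h_def)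
    then show ?thesis using \<open>w \<in> path_image g\<close> by (auto simp: path_image_compose image_Un)
  qed
  have z0de: "z0 \<notin> path_image d" "z0 \<notin> path_image e" using z0 dout eout by blast+
  show False
  proof (rule crossing_chords_not_both_inside[of "h \<circ> c1" "h a" "h b" "h \<circ> c2" "h \<circ> d" "h \<circ> e" "h u" "h v"])
    show "path_image (h \<circ> d) \<inter> inside (path_image (h \<circ> c1) \<union> path_image (h \<circ> c2)) \<noteq> {}"
      using d dout dc by (intro hit) auto
    show "path_image (h \<circ> e) \<inter> inside (path_image (h \<circ> c1) \<union> path_image (h \<circ> c2)) \<noteq> {}"
      using e eout ec by (intro hit) auto
    show "path_image (h \<circ> d) \<inter> (path_image (h \<circ> c1) \<union> path_image (h \<circ> c2)) = {h a, h b}"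
      unfolding path_image_compose image_Un[symmetric] image_Int[OF inj, symmetric] dc by simp
    show "path_image (h \<circ> e) \<inter> (path_image (h \<circ> c1) \<union> path_image (h \<circ> c2)) = {h u, h v}"
      unfolding path_image_compose image_Un[symmetric] image_Int[OF inj, symmetric] ec by simp
    show "path_image (h \<circ> c1) \<inter> path_image (h \<circ> c2) = {h a, h b}"
      unfolding path_image_compose image_Int[OF inj, symmetric] c12 by simp
    show "path_image (h \<circ> d) \<inter> path_image (h \<circ> e) = {}"
      unfolding path_image_compose image_Int[OF inj, symmetric] de by simp
  qed (use assms z0de z0H arch in \<open>auto simp: pathstart_compose pathfinish_compose path_image_compose\<close>)
qed

section \<open>The complete bipartite graph on three and three vertices\<close>

text \<open>A drawing of \<open>K\<^sub>3\<^sub>,\<^sub>3\<close> by nine arcs, with the indices below 3 standing for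
  the vertices of either side.\<close>

locale K33_drawing =
  fixes \<alpha> \<beta> :: "nat \<Rightarrow> complex" and \<gamma> :: "nat \<Rightarrow> nat \<Rightarrow> real \<Rightarrow> complex"
  assumes arc: "i < 3 \<Longrightarrow> j < 3 \<Longrightarrow> arc (\<gamma> i j)"
    and start: "i < 3 \<Longrightarrow> j < 3 \<Longrightarrow> pathstart (\<gamma> i j) = \<alpha> i"
    and finish: "i < 3 \<Longrightarrow> j < 3 \<Longrightarrow> pathfinish (\<gamma> i j) = \<beta> j"
    and same_start: "i < 3 \<Longrightarrow> j < 3 \<Longrightarrow> j' < 3 \<Longrightarrow> j \<noteq> j' \<Longrightarrow>
      path_image (\<gamma> i j) \<inter> path_image (\<gamma> i j') = {\<alpha> i}"
    and same_finish: "i < 3 \<Longrightarrow> i' < 3 \<Longrightarrow> j < 3 \<Longrightarrow> i \<noteq> i' \<Longrightarrow>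
      path_image (\<gamma> i j) \<inter> path_image (\<gamma> i' j) = {\<beta> j}"
    and apart: "i < 3 \<Longrightarrow> i' < 3 \<Longrightarrow> j < 3 \<Longrightarrow> j' < 3 \<Longrightarrow> i \<noteq> i' \<Longrightarrow> j \<noteq> j' \<Longrightarrow>
      path_image (\<gamma> i j) \<inter> path_image (\<gamma> i' j') = {}"
begin

abbreviation img :: "nat \<Rightarrow> nat \<Rightarrow> complex set" where
  "img i j \<equiv> path_image (\<gamma> i j)"

text \<open>The cycle \<open>\<alpha> i, \<beta> i, \<alpha> j, \<beta> j, \<alpha> k, \<beta> k\<close>, written as its two halves between
  \<open>\<alpha> i\<close> and \<open>\<beta> j\<close>, which are the ends of the long diagonal \<open>\<gamma> i j\<close>.\<close>

definition hexagon :: "nat \<Rightarrow> nat \<Rightarrow> nat \<Rightarrow> complex set" where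
  "hexagon i j k = img i i \<union> img j i \<union> img j j \<union> (img i k \<union> img k k \<union> img k j)"

lemma ends_in: "i < 3 \<Longrightarrow> j < 3 \<Longrightarrow> \<alpha> i \<in> img i j" "i < 3 \<Longrightarrow> j < 3 \<Longrightarrow> \<beta> j \<in> img i j"
  using start finish by (metis pathstart_in_path_image, metis pathfinish_in_path_image)

text \<open>The ends of the diagonals \<open>\<gamma> i j\<close> and \<open>\<gamma> j k\<close> separate each other on
  the hexagon, so the two diagonals are crossing chords.\<close>

lemma chords_on_different_sides:
  assumes ijk: "i < 3" "j < 3" "k < 3" "i \<noteq> j" "j \<noteq> k" "i \<noteq> k"
  shows "(img i j \<inter> inside (hexagon i j k) = {}) \<noteq> (img j k \<inter> inside (hexagon i j k) = {})"
proof -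
  define c1 where "c1 = \<gamma> i i +++ (reversepath (\<gamma> j i) +++ \<gamma> j j)"
  define c2 where "c2 = \<gamma> i k +++ (reversepath (\<gamma> k k) +++ \<gamma> k j)"
  note [simp] = ijk ijk(4-6)[symmetric] arc start finish arc_reversepath
  note meets = same_start same_finish apart
  have im: "path_image c1 = img i i \<union> img j i \<union> img j j" "path_image c2 = img i k \<union> img k k \<union> img k j"
    by (auto simp: c1_def c2_def path_image_join)
  then have H: "path_image c1 \<union> path_image c2 = hexagon i j k"
    by (simp add: hexagon_def)
  have c1: "arc c1" "pathstart c1 = \<alpha> i" "pathfinish c1 = \<beta> j"
    unfolding c1_def
    by ((intro arc_join; simp add: path_image_join Int_Un_distrib meets), simp_all)
  have c2: "arc c2" "pathstart c2 = \<alpha> i" "pathfinish c2 = \<beta> j"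
    unfolding c2_def
    by ((intro arc_join; simp add: path_image_join Int_Un_distrib meets), simp_all)
  have c12: "path_image c1 \<inter> path_image c2 = {\<alpha> i, \<beta> j}"
    unfolding im Int_Un_distrib Int_Un_distrib2 by (auto simp: meets)
  have dc: "img i j \<inter> (path_image c1 \<union> path_image c2) = {\<alpha> i, \<beta> j}"
    unfolding im Int_Un_distrib Int_Un_distrib2 by (auto simp: meets)
  have ec: "img j k \<inter> (path_image c1 \<union> path_image c2) = {\<alpha> j, \<beta> k}"
    unfolding im Int_Un_distrib Int_Un_distrib2 by (auto simp: meets)
  have uv: "\<alpha> j \<in> path_image c1" "\<beta> k \<in> path_image c2"
    unfolding im by (simp_all add: ends_in)
  have d: "arc (\<gamma> i j)" "pathstart (\<gamma> i j) = \<alpha> i" "pathfinish (\<gamma> i j) = \<beta> j"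
    and e: "arc (\<gamma> j k)" "pathstart (\<gamma> j k) = \<alpha> j" "pathfinish (\<gamma> j k) = \<beta> k"
    and de: "img i j \<inter> img j k = {}"
    by (simp_all add: meets)
  note chords = c1 c2 d e c12 dc ec de uv
  show ?thesis
    using crossing_chords_not_both_inside[OF chords] crossing_chords_not_both_outside[OF chords]
    unfolding H by blast
qed

text \<open>There are three long diagonals of the hexagon, any two on different sides, but a closed
  curve has only two sides.\<close>

lemma no_K33_drawing: False
proof -
  \<comment> \<open>The hexagon is unchanged when the three indices are rotated, so all three pairs are compared on the same curve.\<close>
  have rot: "hexagon 1 2 0 = hexagon 0 1 2" "hexagon 2 0 1 = hexagon 0 1 2"
    by (auto simp: hexagon_def)
  show False
    using chords_on_different_sides[of 0 1 2] chords_on_different_sides[of 1 2 0]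
      chords_on_different_sides[of 2 0 1]
    unfolding rot by simp
qed

end

section \<open>Subdivisions in planar graphs\<close>

fun walk_edges :: "'a list \<Rightarrow> 'a set set" where
  "walk_edges (x # y # zs) = insert {x, y} (walk_edges (y # zs))"
| "walk_edges _ = {}"

lemma walk_edges_subset: "e \<in> walk_edges xs \<Longrightarrow> e \<subseteq> set xs"
  by (induction xs rule: walk_edges.induct) auto

lemma Union_walk_edges: "length xs \<ge> 2 \<Longrightarrow> \<Union> (walk_edges xs) = set xs"
proof (induction xs rule: walk_edges.induct)
  case (1 x y zs)
  then show ?case by (cases zs) auto
qed auto

text \<open>The condition in the definition of planarity, with the drawing as a parameter.\<close>

definition drawing :: "('v, 'w) weighted_graph \<Rightarrow> ('v \<Rightarrow> complex) \<Rightarrow> ('v set \<Rightarrow> real \<Rightarrow> complex) \<Rightarrow> bool" where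
  "drawing G p c \<longleftrightarrow> inj_on p (vertices G) \<and>
     (\<forall>e\<in>edges G. arc (c e) \<and> {pathstart (c e), pathfinish (c e)} = p ` e \<and>
           path_image (c e) \<inter> p ` vertices G = p ` e) \<and>
     (\<forall>e\<in>edges G. \<forall>e'\<in>edges G. e \<noteq> e' \<longrightarrow>
           path_image (c e) \<inter> path_image (c e') = p ` (e \<inter> e'))"

lemma planar_iff_drawing: "planar G \<longleftrightarrow> (\<exists>p c. drawing G p c)"
  by (simp add: planar_def drawing_def)

lemma drawing_walks_meet:
  assumes D: "drawing G p c"
    and xs: "walk_edges xs \<subseteq> edges G" "length xs \<ge> 2"
    and ys: "walk_edges ys \<subseteq> edges G" "length ys \<ge> 2"
    and disj: "walk_edges xs \<inter> walk_edges ys = {}"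
  shows "(\<Union>e\<in>walk_edges xs. path_image (c e)) \<inter> (\<Union>e\<in>walk_edges ys. path_image (c e))
    = p ` (set xs \<inter> set ys)"
proof -
  have "(\<Union>e\<in>walk_edges xs. path_image (c e)) \<inter> (\<Union>e\<in>walk_edges ys. path_image (c e))
    = (\<Union>e\<in>walk_edges xs. \<Union>e'\<in>walk_edges ys. path_image (c e) \<inter> path_image (c e'))"
    by auto
  also have "\<dots> = (\<Union>e\<in>walk_edges xs. \<Union>e'\<in>walk_edges ys. p ` (e \<inter> e'))"
  proof (intro SUP_cong refl)
    fix e e' assume "e \<in> walk_edges xs" "e' \<in> walk_edges ys"
    then have "e \<in> edges G" "e' \<in> edges G" "e \<noteq> e'" using xs ys disj by auto
    then show "path_image (c e) \<inter> path_image (c e') = p ` (e \<inter> e')"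
      using D by (simp add: drawing_def)
  qed
  also have "\<dots> = p ` (\<Union> (walk_edges xs) \<inter> \<Union> (walk_edges ys))" by blast
  finally show ?thesis using xs ys by (simp add: Union_walk_edges)
qed

lemma drawing_edge_arc:
  assumes D: "drawing G p c" and e: "{x, y} \<in> edges G"
  obtains g where "arc g" "pathstart g = p x" "pathfinish g = p y"
    "path_image g = path_image (c {x, y})"
proof -
  have a: "arc (c {x, y})" "{pathstart (c {x, y}), pathfinish (c {x, y})} = {p x, p y}"
    using D e by (auto simp: drawing_def)
  then consider "pathstart (c {x, y}) = p x" "pathfinish (c {x, y}) = p y"
    | "pathstart (c {x, y}) = p y" "pathfinish (c {x, y}) = p x"
    by (auto simp: doubleton_eq_iff)
  then show ?thesis
  proof cases
    case 1 then show ?thesis using a that by blast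
  next
    case 2 then show ?thesis
      using a that[of "reversepath (c {x, y})"] by (simp add: arc_reversepath)
  qed
qed

text \<open>The arcs drawn for the consecutive edges of a walk without repeated vertices meet only at
  the vertex that they share, so they concatenate to an arc.\<close>

lemma drawing_walk_arc:
  assumes D: "drawing G p c"
  shows "distinct xs \<Longrightarrow> length xs \<ge> 2 \<Longrightarrow> walk_edges xs \<subseteq> edges G \<Longrightarrow>
    \<exists>g. arc g \<and> pathstart g = p (hd xs) \<and> pathfinish g = p (last xs) \<and>
      path_image g = (\<Union>e\<in>walk_edges xs. path_image (c e))"
proof (induction xs rule: walk_edges.induct)
  case (1 x y zs)
  obtain g where g: "arc g" "pathstart g = p x" "pathfinish g = p y"
    "path_image g = path_image (c {x, y})"
    using drawing_edge_arc[OF D, of x y] "1.prems"(3) by auto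
  show ?case
  proof (cases "zs = []")
    case True
    then show ?thesis using g by auto
  next
    case False
    then have len: "length (y # zs) \<ge> 2" by (cases zs) auto
    then obtain h where h: "arc h" "pathstart h = p y" "pathfinish h = p (last zs)"
      "path_image h = (\<Union>e\<in>walk_edges (y # zs). path_image (c e))"
      using 1 False by auto
    have "{x, y} \<notin> walk_edges (y # zs)"
      using walk_edges_subset[of "{x, y}" "y # zs"] "1.prems"(1) by auto
    then have "path_image g \<inter> path_image h = p ` (set [x, y] \<inter> set (y # zs))"
      using drawing_walks_meet[OF D, of "[x, y]" "y # zs"] "1.prems"(3) len g(4) h(4) by auto
    also have "\<dots> = {p y}" using "1.prems"(1) by auto
    finally have "arc (g +++ h)" using g h by (intro arc_join) auto
    then show ?thesis
      using g h False by (intro exI[of _ "g +++ h"]) (simp add: path_image_join)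
  qed
qed auto

text \<open>A drawing of the graph draws every path \<open>P i j\<close> as one arc, and these arcs form a
  drawing of \<open>K\<^sub>3\<^sub>,\<^sub>3\<close>.\<close>

lemma not_planar_if_K33_subdivision:
  fixes a b :: "nat \<Rightarrow> 'v" and P :: "nat \<Rightarrow> nat \<Rightarrow> 'v list"
  assumes path: "\<And>i j. i < 3 \<Longrightarrow> j < 3 \<Longrightarrow>
      distinct (P i j) \<and> length (P i j) \<ge> 2 \<and> walk_edges (P i j) \<subseteq> edges G \<and>
      hd (P i j) = a i \<and> last (P i j) = b j"
    and meet: "\<And>i j i' j'. i < 3 \<Longrightarrow> j < 3 \<Longrightarrow> i' < 3 \<Longrightarrow> j' < 3 \<Longrightarrow> (i, j) \<noteq> (i', j') \<Longrightarrow>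
      walk_edges (P i j) \<inter> walk_edges (P i' j') = {} \<and>
      set (P i j) \<inter> set (P i' j') = (if i = i' then {a i} else if j = j' then {b j} else {})"
  shows "\<not> planar G"
proof
  assume "planar G"
  then obtain p c where D: "drawing G p c" by (auto simp: planar_iff_drawing)
  have "\<forall>i j. \<exists>g. i < 3 \<longrightarrow> j < 3 \<longrightarrow> arc g \<and> pathstart g = p (a i) \<and>
    pathfinish g = p (b j) \<and> path_image g = (\<Union>e\<in>walk_edges (P i j). path_image (c e))"
    using drawing_walk_arc[OF D] path by metis
  then obtain \<gamma> where \<gamma>: "\<forall>i j. i < 3 \<longrightarrow> j < 3 \<longrightarrow> arc (\<gamma> i j) \<and> pathstart (\<gamma> i j) = p (a i) \<and>
    pathfinish (\<gamma> i j) = p (b j) \<and>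
    path_image (\<gamma> i j) = (\<Union>e\<in>walk_edges (P i j). path_image (c e))"
    unfolding choice_iff by blast
  then have g: "arc (\<gamma> i j)" "pathstart (\<gamma> i j) = p (a i)" "pathfinish (\<gamma> i j) = p (b j)"
    "path_image (\<gamma> i j) = (\<Union>e\<in>walk_edges (P i j). path_image (c e))" if "i < 3" "j < 3" for i j
    using that by simp_all
  have m: "path_image (\<gamma> i j) \<inter> path_image (\<gamma> i' j') = p ` (set (P i j) \<inter> set (P i' j'))"
    if "i < 3" "j < 3" "i' < 3" "j' < 3" "(i, j) \<noteq> (i', j')" for i j i' j'
    using drawing_walks_meet[OF D, of "P i j" "P i' j'"] path[OF that(1,2)] path[OF that(3,4)]
      meet[OF that] g(4)[OF that(1,2)] g(4)[OF that(3,4)] by metis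
  interpret K33_drawing "\<lambda>i. p (a i)" "\<lambda>j. p (b j)" \<gamma>
  proof unfold_locales
    fix i i' j j' :: nat
    show "i < 3 \<Longrightarrow> j < 3 \<Longrightarrow> j' < 3 \<Longrightarrow> j \<noteq> j' \<Longrightarrow>
        path_image (\<gamma> i j) \<inter> path_image (\<gamma> i j') = {p (a i)}"
      using m[of i j i j'] meet[of i j i j'] by simp
    show "i < 3 \<Longrightarrow> i' < 3 \<Longrightarrow> j < 3 \<Longrightarrow> i \<noteq> i' \<Longrightarrow>
        path_image (\<gamma> i j) \<inter> path_image (\<gamma> i' j) = {p (b j)}"
      using m[of i j i' j] meet[of i j i' j] by simp
    show "i < 3 \<Longrightarrow> i' < 3 \<Longrightarrow> j < 3 \<Longrightarrow> j' < 3 \<Longrightarrow> i \<noteq> i' \<Longrightarrow> j \<noteq> j' \<Longrightarrow>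
        path_image (\<gamma> i j) \<inter> path_image (\<gamma> i' j') = {}"
      using m[of i j i' j'] meet[of i j i' j'] by simp
  qed (simp_all add: g)
  show False by (rule no_K33_drawing)
qed

section \<open>Crossings that are not nugatory\<close>

text \<open>A crossing splits the closed curve into two loops. If some other double point lies on both
  loops, the curve stays connected when the crossing is removed, and so cannot have points on both
  sides of a closed curve that meets it only there.\<close>

lemma interlaced_crossing_not_nugatory:
  assumes D: "knot_diagram D"
    and st: "s \<in> double_params (curve D)" "t \<in> double_params (curve D)" "s < t"
      "curve D s = curve D t"
    and u: "s < u" "u < t" and v: "v \<in> {0..1} - {s..t}" and uv: "curve D u = curve D v"
  shows "\<not> nugatory D (curve D s)"
proof -
  let ?\<gamma> = "curve D" and ?T = "double_params (curve D)"
  have closed: "?\<gamma> 1 = ?\<gamma> 0" and path: "path ?\<gamma>" and "0 \<notin> ?T"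
    and card2: "card {r \<in> ?T. ?\<gamma> r = ?\<gamma> t} = 2"
    using D st by (auto simp: knot_diagram_def Let_def pathstart_def pathfinish_def valid_path_imp_path)
  have range: "0 < s" "t < 1"
    using st \<open>0 \<notin> ?T\<close> by (auto simp: double_params_def order_less_le)
  have fibre: "r = s \<or> r = t" if r: "r \<in> {0..1}" "?\<gamma> r = ?\<gamma> s" for r
  proof (cases "r = 1")
    case True
    then have "s \<noteq> 0" "?\<gamma> s = ?\<gamma> 0" "s \<in> {0..<1}" using r closed range st(3) by auto
    then have "0 \<in> ?T" unfolding double_params_def by auto
    then show ?thesis using \<open>0 \<notin> ?T\<close> by blast
  next
    case False
    have "finite {r \<in> ?T. ?\<gamma> r = ?\<gamma> t}" using card2 by (intro card_ge_0_finite) simp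
    then have eq: "{s, t} = {r \<in> ?T. ?\<gamma> r = ?\<gamma> t}"
      using st card2 by (intro card_subset_eq) auto
    have "r = s \<or> r \<in> ?T" using False r st by (force simp: double_params_def)
    then show ?thesis using eq r st by auto
  qed
  have con: "connected (?\<gamma> ` I)" if "connected I" "I \<subseteq> {0..1}" for I
    using that path by (intro connected_continuous_image) (auto simp: path_def intro: continuous_on_subset)
  define A where "A = ?\<gamma> ` {s<..<t}"
  define B where "B = ?\<gamma> ` {0..<s} \<union> ?\<gamma> ` {t<..1}"
  have "connected A" unfolding A_def using range by (intro con) auto
  have "?\<gamma> 0 \<in> ?\<gamma> ` {0..<s}" "?\<gamma> 1 \<in> ?\<gamma> ` {t<..1}"
    using range by (simp_all del: image_eqI add: imageI)
  then have "?\<gamma> 0 \<in> ?\<gamma> ` {0..<s} \<inter> ?\<gamma> ` {t<..1}"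
    unfolding closed by blast
  then have "?\<gamma> ` {0..<s} \<inter> ?\<gamma> ` {t<..1} \<noteq> {}" by blast
  then have "connected B" unfolding B_def
    by (rule connected_Un[OF con con, rotated 4]) (use range st in auto)
  have "?\<gamma> u \<in> A" unfolding A_def using u by simp
  moreover have "?\<gamma> v \<in> B" unfolding B_def using v by auto
  ultimately have "A \<inter> B \<noteq> {}" using uv by auto
  then have AB: "connected (A \<union> B)"
    using \<open>connected A\<close> \<open>connected B\<close> by (intro connected_Un) auto
  have "{0..1} = {0..<s} \<union> {s<..<t} \<union> {t<..1} \<union> {s, t}" using range st by auto
  then have im: "path_image ?\<gamma> = A \<union> B \<union> {?\<gamma> s}"
    using st by (auto simp: path_image_def A_def B_def image_Un)
  have nin: "?\<gamma> s \<notin> A \<union> B"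
  proof
    assume "?\<gamma> s \<in> A \<union> B"
    then obtain r where "r \<in> {s<..<t} \<union> {0..<s} \<union> {t<..1}" "?\<gamma> s = ?\<gamma> r"
      unfolding A_def B_def by blast
    then show False using fibre[of r] range st(3) by auto
  qed
  show ?thesis
  proof
    assume "nugatory D (?\<gamma> s)"
    then obtain c where c: "path_image c \<inter> path_image ?\<gamma> = {?\<gamma> s}"
      "inside (path_image c) \<inter> path_image ?\<gamma> \<noteq> {}" "outside (path_image c) \<inter> path_image ?\<gamma> \<noteq> {}"
      unfolding nugatory_def by blast
    have "?\<gamma> s \<in> path_image c" using c by blast
    then have "inside (path_image c) \<inter> (A \<union> B) \<noteq> {}" "outside (path_image c) \<inter> (A \<union> B) \<noteq> {}"
      using c(2,3) inside_no_overlap[of "path_image c"] outside_no_overlap[of "path_image c"]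
      unfolding im by blast+
    then have "path_image c \<inter> (A \<union> B) \<noteq> {}"
      by (rule inside_outside_intersect_connected[OF AB])
    then obtain y where "y \<in> path_image c" "y \<in> A \<union> B" by blast
    then have "y = ?\<gamma> s" using c(1) unfolding im by blast
    then show False using nin \<open>y \<in> A \<union> B\<close> by blast
  qed
qed

section \<open>The curve and its double points\<close>

text \<open>A closed hexagonal line with six self-crossings. Its six segments are traversed over the
  parameter intervals with ends \<open>0, 1/4, 3/8, 1/2, 3/4, 7/8, 1\<close>.\<close>

definition star :: "real \<Rightarrow> complex" where
  "star =
     (linepath (Complex 2 1) (Complex 1 2) +++ linepath (Complex 1 2) (Complex 2 0) +++
        linepath (Complex 2 0) (Complex 1 0)) +++
     (linepath (Complex 1 0) (Complex 2 2) +++ linepath (Complex 2 2) (Complex 0 0) +++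
        linepath (Complex 0 0) (Complex 2 1))"

lemma valid_path_star: "valid_path star" "pathstart star = Complex 2 1" "pathfinish star = Complex 2 1"
  by (simp_all add: star_def)

lemma star_eq:
  "star t =
     (if t \<le> 1/4 then Complex 2 1 + t *\<^sub>R Complex (-4) 4
      else if t \<le> 3/8 then Complex (-1) 6 + t *\<^sub>R Complex 8 (-16)
      else if t \<le> 1/2 then Complex 5 0 + t *\<^sub>R Complex (-8) 0
      else if t \<le> 3/4 then Complex (-1) (-4) + t *\<^sub>R Complex 4 8
      else if t \<le> 7/8 then Complex 14 14 + t *\<^sub>R Complex (-16) (-16)
      else Complex (-14) (-7) + t *\<^sub>R Complex 16 8)"
  by (auto simp: star_def joinpaths_def linepath_def complex_eq_iff algebra_simps)

text \<open>The two parameters of each of the six double points, in increasing order.\<close>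

definition star_pairs :: "(real \<times> real) set" where
  "star_pairs = {(1/12, 2/3), (1/8, 25/32), (7/24, 19/24), (5/16, 5/8), (13/40, 39/40), (7/12, 23/24)}"

text \<open>On a pair of segments the equation \<open>star s = star t\<close> is a linear system in \<open>s\<close>
  and \<open>t\<close>: for six of the pairs its solution is one of the listed crossings, and in all other
  cases it contradicts the range of the parameters.\<close>

lemma star_pairsD:
  assumes "0 \<le> s" "s < t" "t < 1" "star s = star t"
  shows "(s, t) \<in> star_pairs"
proof -
  have c: "s = 1/12 \<Longrightarrow> t = 2/3 \<Longrightarrow> (s, t) \<in> star_pairs"
    "s = 1/8 \<Longrightarrow> t = 25/32 \<Longrightarrow> (s, t) \<in> star_pairs"
    "s = 7/24 \<Longrightarrow> t = 19/24 \<Longrightarrow> (s, t) \<in> star_pairs"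
    "s = 5/16 \<Longrightarrow> t = 5/8 \<Longrightarrow> (s, t) \<in> star_pairs"
    "s = 13/40 \<Longrightarrow> t = 39/40 \<Longrightarrow> (s, t) \<in> star_pairs"
    "s = 7/12 \<Longrightarrow> t = 23/24 \<Longrightarrow> (s, t) \<in> star_pairs"
    by (auto simp: star_pairs_def)
  have piece: "r \<le> 1/4 \<and> Re (star r) = 2 - 4 * r \<and> Im (star r) = 1 + 4 * r \<or>
      1/4 < r \<and> r \<le> 3/8 \<and> Re (star r) = - 1 + 8 * r \<and> Im (star r) = 6 - 16 * r \<or>
      3/8 < r \<and> r \<le> 1/2 \<and> Re (star r) = 5 - 8 * r \<and> Im (star r) = 0 \<or>
      1/2 < r \<and> r \<le> 3/4 \<and> Re (star r) = - 1 + 4 * r \<and> Im (star r) = - 4 + 8 * r \<or>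
      3/4 < r \<and> r \<le> 7/8 \<and> Re (star r) = 14 - 16 * r \<and> Im (star r) = 14 - 16 * r \<or>
      7/8 < r \<and> Re (star r) = - 14 + 16 * r \<and> Im (star r) = - 7 + 8 * r" for r
    by (auto simp: star_eq)
  have "Re (star s) = Re (star t)" "Im (star s) = Im (star t)" using assms(4) by simp_all
  with assms(1-3) piece[of s] piece[of t] show ?thesis
    by (elim disjE conjE)
      ((rule FalseE, linarith | (rule c(1); linarith) | (rule c(2); linarith) | (rule c(3); linarith)
        | (rule c(4); linarith) | (rule c(5); linarith) | (rule c(6); linarith))+)
qed

lemma star_pairs_cases:
  assumes "(s, t) \<in> star_pairs"
    and "P (1/12) (2/3)" "P (1/8) (25/32)" "P (7/24) (19/24)" "P (5/16) (5/8)" "P (13/40) (39/40)"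
      "P (7/12) (23/24)"
  shows "P s t"
  using assms unfolding star_pairs_def by blast

lemma star_pairs_bounds: "(s, t) \<in> star_pairs \<Longrightarrow> 0 < s \<and> s < t \<and> t < 1 \<and> star s = star t"
  by (erule star_pairs_cases) (simp_all add: star_eq complex_eq_iff)

lemma star_pairs_unique:
  assumes "(s, t) \<in> star_pairs" "(s', t') \<in> star_pairs"
  shows "(s = s' \<longleftrightarrow> t = t') \<and> s \<noteq> t' \<and> t \<noteq> s'"
  by (rule star_pairs_cases[OF assms(1)]; rule star_pairs_cases[OF assms(2)]) simp_all

lemma star_meets_iff:
  assumes "s \<in> {0..<1}" "t \<in> {0..<1}"
  shows "s \<noteq> t \<and> star s = star t \<longleftrightarrow> (s, t) \<in> star_pairs \<or> (t, s) \<in> star_pairs"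
proof
  assume "s \<noteq> t \<and> star s = star t"
  then consider "s < t" "star s = star t" | "t < s" "star t = star s" by fastforce
  then show "(s, t) \<in> star_pairs \<or> (t, s) \<in> star_pairs"
    by cases (use assms star_pairsD in simp_all)
next
  assume "(s, t) \<in> star_pairs \<or> (t, s) \<in> star_pairs"
  then show "s \<noteq> t \<and> star s = star t" using star_pairs_bounds by fastforce
qed

lemma double_params_star:
  "double_params star = {1/12, 2/3, 1/8, 25/32, 7/24, 19/24, 5/16, 5/8, 13/40, 39/40, 7/12, 23/24}"
proof -
  have "double_params star = fst ` star_pairs \<union> snd ` star_pairs"
  proof (intro equalityI subsetI)
    fix t assume "t \<in> double_params star"
    then obtain s where "s \<in> {0..<1}" "t \<in> {0..<1}" "s \<noteq> t \<and> star s = star t"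
      by (auto simp: double_params_def)
    then show "t \<in> fst ` star_pairs \<union> snd ` star_pairs"
      using star_meets_iff[of s t] by force
  next
    fix t assume "t \<in> fst ` star_pairs \<union> snd ` star_pairs"
    then obtain s where "(s, t) \<in> star_pairs \<or> (t, s) \<in> star_pairs" by force
    then have "s \<in> {0..<1} \<and> t \<in> {0..<1} \<and> s \<noteq> t \<and> star s = star t"
      using star_pairs_bounds[of s t] star_pairs_bounds[of t s] by auto
    then show "t \<in> double_params star" by (auto simp: double_params_def)
  qed
  then show ?thesis by (auto simp: star_pairs_def)
qed

section \<open>A reduced knot diagram\<close>

text \<open>The curve passes under at its first visit to every crossing except the one with parameters
  1/8 and 25/32. With this choice crossings 0 and 5 both involve exactly the arcs 0, 1
  and 5. Crossing 1 involves the arcs 0, 1 and 2, and crossing 2 the arcs 2, 3 and 5, so that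
  crossing 1 is linked to arc 5 through arc 2 and crossing 2, also after the column of arc 3 is
  deleted.\<close>

definition star_diagram :: diagram where
  "star_diagram = \<lparr>curve = star, under = {1/12, 7/24, 5/16, 13/40, 7/12, 25/32}\<rparr>"

lemma affine_derivative:
  fixes P V :: complex
  assumes "l < t" "t < r" and f: "\<And>x. l < x \<Longrightarrow> x < r \<Longrightarrow> f x = P + x *\<^sub>R V"
  shows "(f has_vector_derivative V) (at t)"
proof -
  have "((\<lambda>x. P + x *\<^sub>R V) has_vector_derivative V) (at t)"
    by (auto intro!: derivative_eq_intros)
  then show ?thesis
    by (rule has_vector_derivative_transform_within_open[of _ _ _ "{l<..<r}"]) (use assms in auto)
qed

lemma star_derivative:
  "0 < t \<Longrightarrow> t < 1/4 \<Longrightarrow> (star has_vector_derivative Complex (-4) 4) (at t)"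
  "1/4 < t \<Longrightarrow> t < 3/8 \<Longrightarrow> (star has_vector_derivative Complex 8 (-16)) (at t)"
  "1/2 < t \<Longrightarrow> t < 3/4 \<Longrightarrow> (star has_vector_derivative Complex 4 8) (at t)"
  "3/4 < t \<Longrightarrow> t < 7/8 \<Longrightarrow> (star has_vector_derivative Complex (-16) (-16)) (at t)"
  "7/8 < t \<Longrightarrow> t < 1 \<Longrightarrow> (star has_vector_derivative Complex 16 8) (at t)"
  by ((rule affine_derivative[of 0 t "1/4"]; auto simp: star_eq),
    (rule affine_derivative[of "1/4" t "3/8"]; auto simp: star_eq),
    (rule affine_derivative[of "1/2" t "3/4"]; auto simp: star_eq),
    (rule affine_derivative[of "3/4" t "7/8"]; auto simp: star_eq),
    (rule affine_derivative[of "7/8" t 1]; auto simp: star_eq))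

lemma star_crossing_directions:
  assumes "(s, t) \<in> star_pairs"
  shows "\<exists>V W. (star has_vector_derivative V) (at s) \<and> (star has_vector_derivative W) (at t) \<and>
    Re V * Im W \<noteq> Im V * Re W"
proof -
  note d = star_derivative
  have dir: "\<exists>V W. (star has_vector_derivative V) (at s) \<and> (star has_vector_derivative W) (at t) \<and>
      Re V * Im W \<noteq> Im V * Re W"
    if "(star has_vector_derivative V) (at s)" "(star has_vector_derivative W) (at t)"
      "Re V * Im W \<noteq> Im V * Re W" for s t V W
    using that by blast
  show ?thesis
    \<comment> \<open>The rules give, crossing by crossing, the segments of the two strands.\<close>
    by (rule star_pairs_cases[OF assms]; rule dir)
      (rule d(1) d(3) d(1) d(4) d(2) d(4) d(2) d(3) d(2) d(5) d(3) d(5) | simp)+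
qed

lemma independent_complex:
  fixes V W :: complex
  assumes "Re V * Im W \<noteq> Im V * Re W" "a *\<^sub>R V + b *\<^sub>R W = 0"
  shows "a = 0 \<and> b = 0"
proof -
  have e: "a * Re V + b * Re W = 0" "a * Im V + b * Im W = 0"
    using assms(2) by (simp_all add: complex_eq_iff)
  have "a * (Re V * Im W - Im V * Re W) = 0" "b * (Re V * Im W - Im V * Re W) = 0"
    using arg_cong2[OF e, of "\<lambda>x y. Im W * x - Re W * y"] arg_cong2[OF e, of "\<lambda>x y. Re V * y - Im V * x"]
    by (simp_all add: algebra_simps)
  then show ?thesis using assms(1) by simp
qed

lemma under_star_pairs:
  "(s, t) \<in> star_pairs \<Longrightarrow> s \<in> under star_diagram \<longleftrightarrow> t \<notin> under star_diagram"
  by (erule star_pairs_cases) (simp_all add: star_diagram_def)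

lemma knot_diagram_star: "knot_diagram star_diagram"
proof -
  let ?T = "double_params star" and ?U = "under star_diagram"
  have T01: "t \<in> {0..<1}" if "t \<in> ?T" for t using that by (simp add: double_params_def)
  have meet: "(s, t) \<in> star_pairs \<or> (t, s) \<in> star_pairs"
    if "s \<in> ?T" "t \<in> ?T" "s \<noteq> t" "star s = star t" for s t
    using that star_meets_iff T01 by blast
  have partner: "\<exists>s\<in>?T. (s, t) \<in> star_pairs \<or> (t, s) \<in> star_pairs" if "t \<in> ?T" for t
  proof -
    obtain s where "s \<in> {0..<1}" "s \<noteq> t" "star s = star t"
      using \<open>t \<in> ?T\<close> by (auto simp: double_params_def)
    then have "s \<in> ?T" using T01[OF that] by (force simp: double_params_def)
    then show ?thesis using meet[of s t] that \<open>s \<noteq> t\<close> \<open>star s = star t\<close> by blast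
  qed
  have unique: "s = s'"
    if "(s, t) \<in> star_pairs \<or> (t, s) \<in> star_pairs" "(s', t) \<in> star_pairs \<or> (t, s') \<in> star_pairs" for s s' t
    using that star_pairs_unique by blast
  have "card {s \<in> ?T. star s = star t} = 2" if t: "t \<in> ?T" for t
  proof -
    obtain s where s: "s \<in> ?T" "(s, t) \<in> star_pairs \<or> (t, s) \<in> star_pairs"
      using partner[OF t] by blast
    then have "s \<noteq> t" "star s = star t" using star_pairs_bounds by force+
    moreover have "r = s" if "r \<in> ?T" "r \<noteq> t" "star r = star t" for r
      using unique[OF meet[OF that(1) t that(2,3)] s(2)] .
    ultimately have "{r \<in> ?T. star r = star t} = {s, t}" using s t by blast
    then show ?thesis using \<open>s \<noteq> t\<close> by simp
  qed
  moreover have "star differentiable (at t)" if "t \<in> ?T" for t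
    using partner[OF that] star_crossing_directions
    by (meson differentiableI_vector)
  moreover have "a = 0 \<and> b = 0"
    if "s \<in> ?T" "t \<in> ?T" "s \<noteq> t" "star s = star t"
      "a *\<^sub>R vector_derivative star (at s) + b *\<^sub>R vector_derivative star (at t) = 0" for s t a b
  proof -
    have "Re (vector_derivative star (at s)) * Im (vector_derivative star (at t))
        \<noteq> Im (vector_derivative star (at s)) * Re (vector_derivative star (at t))"
      using meet[OF that(1-4)] star_crossing_directions[of s t] star_crossing_directions[of t s]
      by (auto simp: vector_derivative_at mult.commute)
    then show ?thesis using independent_complex that(5) by blast
  qed
  moreover have "s \<in> ?U \<longleftrightarrow> t \<notin> ?U" if "s \<in> ?T" "t \<in> ?T" "s \<noteq> t" "star s = star t" for s t
    using meet[OF that] under_star_pairs by blast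
  moreover have "finite ?T" "0 \<notin> ?T" "?U \<subseteq> ?T"
    by (auto simp: double_params_star star_diagram_def)
  ultimately show ?thesis
    using valid_path_star by (simp add: knot_diagram_def Let_def star_diagram_def)
qed

lemma crossings_star: "crossings star_diagram = (star \<circ> fst) ` star_pairs"
proof -
  have "star ` double_params star = (star \<circ> fst) ` star_pairs \<union> (star \<circ> snd) ` star_pairs"
    unfolding double_params_star by (auto simp: star_pairs_def)
  also have "(star \<circ> snd) ` star_pairs = (star \<circ> fst) ` star_pairs"
    by (intro image_cong refl) (use star_pairs_bounds in force)
  finally show ?thesis by (simp add: crossings_def star_diagram_def)
qed

lemma reduced_diagram_star: "reduced_diagram star_diagram"
  unfolding reduced_diagram_def
proof
  fix x assume "x \<in> crossings star_diagram"
  then obtain s t where st: "(s, t) \<in> star_pairs" "x = star s"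
    by (auto simp: crossings_star)
  have "\<exists>u v. s < u \<and> u < t \<and> v \<in> {0..1} - {s..t} \<and> ((u, v) \<in> star_pairs \<or> (v, u) \<in> star_pairs)"
  proof -
    \<comment> \<open>For each crossing, another crossing that is visited once strictly between its two passages.\<close>
    have wit: "\<exists>u v. s < u \<and> u < t \<and> v \<in> {0..1} - {s..t} \<and> ((u, v) \<in> star_pairs \<or> (v, u) \<in> star_pairs)"
      if "s < u" "u < t" "v \<in> {0..1} - {s..t}" "(u, v) \<in> star_pairs \<or> (v, u) \<in> star_pairs" for s t u v
      using that by blast
    show ?thesis
      by (rule star_pairs_cases[OF st(1)],
        (rule wit[of _ "1/8" _ "25/32"]; simp add: star_pairs_def),
        (rule wit[of _ "2/3" _ "1/12"]; simp add: star_pairs_def),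
        (rule wit[of _ "7/12" _ "23/24"]; simp add: star_pairs_def),
        (rule wit[of _ "13/40" _ "39/40"]; simp add: star_pairs_def),
        (rule wit[of _ "5/8" _ "5/16"]; simp add: star_pairs_def),
        (rule wit[of _ "19/24" _ "7/24"]; simp add: star_pairs_def))
  qed
  then obtain u v where uv: "s < u" "u < t" "v \<in> {0..1} - {s..t}" "star u = star v"
    using star_pairs_bounds by metis
  have "s \<in> double_params star" "t \<in> double_params star" "s < t" "star s = star t"
    using st star_pairs_bounds[of s t] by (force simp: double_params_def)+
  then show "\<not> nugatory star_diagram x"
    using interlaced_crossing_not_nugatory[OF knot_diagram_star, of s t u v] uv st
    by (simp add: star_diagram_def)
qed

section \<open>The torsion matrix and its graph\<close>

lemma crossing_number_star: "crossing_number star_diagram = 6"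
  unfolding crossing_number_def crossings_star star_pairs_def
  by (simp add: star_eq complex_eq_iff card_insert_if)

lemma sorted_under_star:
  "sorted_list_of_set (under star_diagram) = [1/12, 7/24, 5/16, 13/40, 7/12, 25/32]"
proof -
  have "under star_diagram = set [1/12, 7/24, 5/16, 13/40, 7/12, 25/32]"
    by (simp add: star_diagram_def)
  then show ?thesis
    by (simp only: sorted_list_of_set.idem_if_sorted_distinct) simp
qed

lemma over_param_star:
  assumes "i < 6"
  shows "over_param star_diagram i = [2/3, 19/24, 5/8, 39/40, 23/24, 1/8] ! i"
    (is "_ = ?o")
proof -
  let ?u = "under_param star_diagram i"
  have u: "?u = [1/12, 7/24, 5/16, 13/40, 7/12, 25/32] ! i"
    by (simp add: under_param_def sorted_under_star)
  have i: "i = 0 \<or> i = 1 \<or> i = 2 \<or> i = 3 \<or> i = 4 \<or> i = 5" using assms by auto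
  have m: "(t, ?u) \<in> star_pairs \<or> (?u, t) \<in> star_pairs \<longleftrightarrow> t = ?o" for t
    unfolding u using i by (elim disjE) (auto simp: star_pairs_def)
  have u': "?u \<in> {0..<1}" "?u \<in> under star_diagram"
    unfolding u using i by (auto simp: star_diagram_def)
  have o: "?o \<in> double_params star" "?o \<notin> under star_diagram"
    using i by (elim disjE; simp add: double_params_star star_diagram_def)+
  have "star ?o = star ?u"
    using m[of ?o] star_pairs_bounds[of ?o ?u] star_pairs_bounds[of ?u ?o] by fastforce
  show ?thesis unfolding over_param_def
  proof (rule the_equality)
    show "?o \<in> double_params (curve star_diagram) - under star_diagram \<and>
        curve star_diagram ?o = curve star_diagram ?u"
      using o \<open>star ?o = star ?u\<close> by (simp add: star_diagram_def)
  next
    fix t assume t: "t \<in> double_params (curve star_diagram) - under star_diagram \<and>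
        curve star_diagram t = curve star_diagram ?u"
    then have "t \<in> {0..<1}" "t \<noteq> ?u" "star t = star ?u"
      using u' by (auto simp: star_diagram_def double_params_def)
    then show "t = ?o" using m star_meets_iff u' by blast
  qed
qed

lemma arc_of_star: "arc_of star_diagram t =
  length (filter (\<lambda>u. u < t) [1/12, 7/24, 5/16, 13/40, 7/12, 25/32]) mod 6"
proof -
  have "length (filter (\<lambda>u. u < t) [1/12, 7/24, 5/16, 13/40, 7/12, 25/32]) =
      card ({u. u < t} \<inter> set [1/12, 7/24, 5/16, 13/40, 7/12, 25/32])"
    by (intro distinct_length_filter) simp
  also have "{u. u < t} \<inter> set [1/12, 7/24, 5/16, 13/40, 7/12, 25/32] = {u \<in> under star_diagram. u < t}"
    by (auto simp: star_diagram_def)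
  finally show ?thesis by (simp add: arc_of_def crossing_number_star)
qed

lemma over_arc_star:
  assumes "i < 6"
  shows "arc_of star_diagram (over_param star_diagram i) = [5, 0, 5, 0, 0, 1] ! i"
proof -
  have "i = 0 \<or> i = 1 \<or> i = 2 \<or> i = 3 \<or> i = 4 \<or> i = 5" using assms by auto
  then show ?thesis
    by (elim disjE) (simp_all add: over_param_star arc_of_star)
qed

text \<open>Rows 0, 1, 2, 3, 4 belong to crossings 0, 1, 2, 3, 5, and columns 0, 1, 2, 3, 4 to
  arcs 0, 1, 2, 4, 5.\<close>

lemma fox_torsion_matrix_star:
  assumes "i < 5" "j < 5"
  shows "fox_torsion_matrix star_diagram 4 3 $$ (i, j) =
    [[-1, -1, 0, 0, 2],
     [2, -1, -1, 0, 0],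
     [0, 0, -1, 0, 2],
     [2, 0, 0, -1, 0],
     [-1, 2, 0, 0, -1]] ! i ! j"
proof -
  have i: "i = 0 \<or> i = 1 \<or> i = 2 \<or> i = 3 \<or> i = 4" and j: "j = 0 \<or> j = 1 \<or> j = 2 \<or> j = 3 \<or> j = 4"
    using assms by auto
  show ?thesis
    using i j
    by (elim disjE) (simp_all add: fox_torsion_matrix_def mat_delete_def fox_matrix_def Let_def
        crossing_number_star over_arc_star)
qed

lemma star_torsion_edge:
  "{Inl i, Inr j} \<in> edges (matrix_graph (fox_torsion_matrix star_diagram 4 3))
    \<longleftrightarrow> i < 5 \<and> j < 5 \<and> fox_torsion_matrix star_diagram 4 3 $$ (i, j) \<noteq> 0"
proof -
  have "dim_row (fox_torsion_matrix star_diagram 4 3) = 5" "dim_col (fox_torsion_matrix star_diagram 4 3) = 5"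
    by (simp_all add: fox_torsion_matrix_def fox_matrix_def Let_def crossing_number_star)
  then show ?thesis by (auto simp: matrix_graph_def doubleton_eq_iff)
qed

text \<open>Rows 0, 1, 4 and columns 0, 1, 4 of the matrix have no zero entry except in row 1 and column
  4. This missing edge of \<open>K\<^sub>3\<^sub>,\<^sub>3\<close> is replaced by the path through column 2 and row 2.\<close>

lemma not_planar_star: "\<not> planar (matrix_graph (fox_torsion_matrix star_diagram 4 3))"
proof -
  define a :: "nat \<Rightarrow> nat + nat" where "a i = Inl ([0, 1, 4] ! i)" for i
  define b :: "nat \<Rightarrow> nat + nat" where "b j = Inr ([0, 1, 4] ! j)" for j
  define P where "P i j = (if i = 1 \<and> j = 2 then [a 1, Inr 2, Inl 2, b 2] else [a i, b j])" for i j
  have three: "i < 3 \<Longrightarrow> i = 0 \<or> i = 1 \<or> i = 2" for i :: nat by auto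
  \<comment> \<open>The long path traverses its middle edge from the column vertex to the row vertex.\<close>
  note edge = star_torsion_edge star_torsion_edge[unfolded insert_commute[of "Inl _"]]
  show ?thesis
  proof (rule not_planar_if_K33_subdivision[of P _ a b])
    fix i j :: nat assume "i < 3" "j < 3"
    then show "distinct (P i j) \<and> length (P i j) \<ge> 2 \<and>
        walk_edges (P i j) \<subseteq> edges (matrix_graph (fox_torsion_matrix star_diagram 4 3)) \<and>
        hd (P i j) = a i \<and> last (P i j) = b j"
      by (auto dest!: three simp: P_def a_def b_def edge fox_torsion_matrix_star)
  next
    fix i j i' j' :: nat assume lt: "i < 3" "j < 3" "i' < 3" "j' < 3" and "(i, j) \<noteq> (i', j')"
    then show "walk_edges (P i j) \<inter> walk_edges (P i' j') = {} \<and>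
        set (P i j) \<inter> set (P i' j') = (if i = i' then {a i} else if j = j' then {b j} else {})"
      using three[OF lt(1)] three[OF lt(2)] three[OF lt(3)] three[OF lt(4)]
      by (elim disjE) (simp_all add: P_def a_def b_def doubleton_eq_iff)
  qed
qed

theorem mainTheorem6:
  shows "\<exists>(D :: diagram) r s. knot_diagram D \<and> reduced_diagram D \<and>
           r < crossing_number D \<and> s < crossing_number D \<and>
           \<not> planar (matrix_graph (fox_torsion_matrix D r s))"
  using knot_diagram_star reduced_diagram_star not_planar_star
  by (intro exI[of _ star_diagram] exI[of _ 4] exI[of _ 3]) (simp add: crossing_number_star)

end
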